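(* Let $\mathcal{T}$ be a rooted prefix tree with finite set $V$ of cacheable chunks, let $\mathcal{M}=\{1,\ldots,M\}$ be a set of workers, with budgets $k_m$, demands $\Lambda_m(b)\ge 0$, recomputation costs $w_m(b)\ge 0$ and fetch costs $f_m(b)\ge 0$ for $m\in\mathcal{M}$, $b\in V$. For every feasible placement $\boldsymbol{T}=(T_1,\ldots,T_M)$, the total materialization-cost savings $F(\boldsymbol{T})$ relative to the all-recompute baseline equal exactly $$F(\boldsymbol{T})=\sum_{m=1}^{M}\sum_{b\in T_m}a_m(b)+\sum_{b\in\bigcup_m T_m}\Delta(b),$$ where $$a_m(b)=\Lambda_m(b)\min\{w_m(b),f_m(b)\},\qquad \Delta(b)=\sum_{m=1}^{M}\Lambda_m(b)\,[w_m(b)-f_m(b)]_+ .$$ Consequently, regarded as a set function $F:2^{\mathcal{E}}\to\mathbb{R}_+$ over the ground set $\mathcal{E}=\{(m,b): m\in\mathcal{M},\ b\in V\}$ of worker--chunk placement elements, $F$ is nonnegative, monotone, and submodular.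
   Context: Notation: $[x]_+=\max\{x,0\}$. The tree $\mathcal{T}$ may have an additional no-cost dummy root (the empty prefix), which is not in $V$, is always present and does not consume budget. A placement is a tuple $\boldsymbol{T}=(T_1,\ldots,T_M)$ with $T_m\subseteq V$; it is feasible if for each $m$ one has $|T_m|\le k_m$ and $T_m$ is parent-closed (if a node is in $T_m$, so is every ancestor of it in $V$). Cost model: under placement $\boldsymbol{T}$, the materialization cost paid by requester $m$ for one unit of demand for chunk $b$ is: $0$ if $b\in T_m$; $\min\{w_m(b),f_m(b)\}$ if $b\notin T_m$ but $b\in T_h$ for some $h\neq m$; and $w_m(b)$ if no worker stores $b$. The total materialization cost is the sum over all $m\in\mathcal{M}$, $b\in V$ of $\Lambda_m(b)$ times this unit cost. The all-recompute baseline is the cost $\sum_{m,b}\Lambda_m(b)w_m(b)$, obtained when no chunk is stored. The total materialization-cost savings of $\boldsymbol{T}$ are the baseline cost minus the total materialization cost under $\boldsymbol{T}$. A subset $S\subseteq\mathcal{E}$ is identified with the tuple $(T_1,\ldots,T_M)$ where $T_m=\{b:(m,b)\in S\}$ (not necessarily feasible), and $F(S)$ is given by the displayed formula for this tuple. Monotone means $F(A)\le F(B)$ for $A\subseteq B$; submodular means $F(A\cup\{e\})-F(A)\ge F(B\cup\{e\})-F(B)$ for $A\subseteq B$ and $e\notin B$. *)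

theory Defs
  imports Complex_Main
begin

text \<open>Edges point from parent to child.\<close>

definition rooted_tree :: "'v set \<Rightarrow> 'v \<Rightarrow> ('v \<times> 'v) set \<Rightarrow> bool" where
  "rooted_tree N r E \<longleftrightarrow>
     r \<in> N \<and> E \<subseteq> N \<times> N \<and>
     (\<forall>p. (p, r) \<notin> E) \<and>
     (\<forall>v\<in>N - {r}. \<exists>!p. (p, v) \<in> E) \<and>
     (\<forall>v\<in>N. (r, v) \<in> E\<^sup>*)"

text \<open>
  The nodes are prefixes, each standing for the chunk it ends with.  The cacheable chunks
  \<open>V\<close> are all nodes, or all nodes except the root; in the second case the root is the
  dummy root (empty prefix), which is never placed and consumes no budget.
\<close>

definition prefix_tree :: "'v set \<Rightarrow> 'v \<Rightarrow> ('v \<times> 'v) set \<Rightarrow> 'v set \<Rightarrow> bool" where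
  "prefix_tree N r E V \<longleftrightarrow> rooted_tree N r E \<and> finite V \<and> (V = N \<or> V = N - {r})"

definition parent_closed :: "('v \<times> 'v) set \<Rightarrow> 'v set \<Rightarrow> 'v set \<Rightarrow> bool" where
  "parent_closed E V T \<longleftrightarrow> (\<forall>b\<in>T. \<forall>a\<in>V. (a, b) \<in> E\<^sup>+ \<longrightarrow> a \<in> T)"

text \<open>
  The workers are \<open>{1..M}\<close>.  A placement is a function \<open>T\<close> from worker indices to sets of
  chunks; its values outside \<open>{1..M}\<close> are never used.
\<close>

definition feasible ::
  "('v \<times> 'v) set \<Rightarrow> 'v set \<Rightarrow> nat \<Rightarrow> (nat \<Rightarrow> nat) \<Rightarrow> (nat \<Rightarrow> 'v set) \<Rightarrow> bool" where
  "feasible E V M k T \<longleftrightarrow>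
     (\<forall>m\<in>{1..M}. T m \<subseteq> V \<and> card (T m) \<le> k m \<and> parent_closed E V (T m))"

definition unit_cost ::
  "nat \<Rightarrow> (nat \<Rightarrow> 'v \<Rightarrow> real) \<Rightarrow> (nat \<Rightarrow> 'v \<Rightarrow> real) \<Rightarrow> (nat \<Rightarrow> 'v set) \<Rightarrow> nat \<Rightarrow> 'v \<Rightarrow> real" where
  "unit_cost M w f T m b =
     (if b \<in> T m then 0
      else if \<exists>h\<in>{1..M}. h \<noteq> m \<and> b \<in> T h then min (w m b) (f m b)
      else w m b)"

definition total_cost ::
  "'v set \<Rightarrow> nat \<Rightarrow> (nat \<Rightarrow> 'v \<Rightarrow> real) \<Rightarrow> (nat \<Rightarrow> 'v \<Rightarrow> real) \<Rightarrow> (nat \<Rightarrow> 'v \<Rightarrow> real) \<Rightarrow>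
   (nat \<Rightarrow> 'v set) \<Rightarrow> real" where
  "total_cost V M \<Lambda> w f T = (\<Sum>m=1..M. \<Sum>b\<in>V. \<Lambda> m b * unit_cost M w f T m b)"

definition baseline_cost ::
  "'v set \<Rightarrow> nat \<Rightarrow> (nat \<Rightarrow> 'v \<Rightarrow> real) \<Rightarrow> (nat \<Rightarrow> 'v \<Rightarrow> real) \<Rightarrow> real" where
  "baseline_cost V M \<Lambda> w = (\<Sum>m=1..M. \<Sum>b\<in>V. \<Lambda> m b * w m b)"

definition total_savings ::
  "'v set \<Rightarrow> nat \<Rightarrow> (nat \<Rightarrow> 'v \<Rightarrow> real) \<Rightarrow> (nat \<Rightarrow> 'v \<Rightarrow> real) \<Rightarrow> (nat \<Rightarrow> 'v \<Rightarrow> real) \<Rightarrow>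
   (nat \<Rightarrow> 'v set) \<Rightarrow> real" where
  "total_savings V M \<Lambda> w f T = baseline_cost V M \<Lambda> w - total_cost V M \<Lambda> w f T"

definition local_gain ::
  "(nat \<Rightarrow> 'v \<Rightarrow> real) \<Rightarrow> (nat \<Rightarrow> 'v \<Rightarrow> real) \<Rightarrow> (nat \<Rightarrow> 'v \<Rightarrow> real) \<Rightarrow> nat \<Rightarrow> 'v \<Rightarrow> real" where
  "local_gain \<Lambda> w f m b = \<Lambda> m b * min (w m b) (f m b)"

definition coverage_gain ::
  "nat \<Rightarrow> (nat \<Rightarrow> 'v \<Rightarrow> real) \<Rightarrow> (nat \<Rightarrow> 'v \<Rightarrow> real) \<Rightarrow> (nat \<Rightarrow> 'v \<Rightarrow> real) \<Rightarrow> 'v \<Rightarrow> real" where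
  "coverage_gain M \<Lambda> w f b = (\<Sum>m=1..M. \<Lambda> m b * max (w m b - f m b) 0)"

definition savings_formula ::
  "nat \<Rightarrow> (nat \<Rightarrow> 'v \<Rightarrow> real) \<Rightarrow> (nat \<Rightarrow> 'v \<Rightarrow> real) \<Rightarrow> (nat \<Rightarrow> 'v \<Rightarrow> real) \<Rightarrow>
   (nat \<Rightarrow> 'v set) \<Rightarrow> real" where
  "savings_formula M \<Lambda> w f T =
     (\<Sum>m=1..M. \<Sum>b\<in>T m. local_gain \<Lambda> w f m b)
     + (\<Sum>b\<in>(\<Union>m\<in>{1..M}. T m). coverage_gain M \<Lambda> w f b)"

definition ground_set :: "nat \<Rightarrow> 'v set \<Rightarrow> (nat \<times> 'v) set" where
  "ground_set M V = {1..M} \<times> V"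

definition savings_set_fun ::
  "nat \<Rightarrow> (nat \<Rightarrow> 'v \<Rightarrow> real) \<Rightarrow> (nat \<Rightarrow> 'v \<Rightarrow> real) \<Rightarrow> (nat \<Rightarrow> 'v \<Rightarrow> real) \<Rightarrow>
   (nat \<times> 'v) set \<Rightarrow> real" where
  "savings_set_fun M \<Lambda> w f S = savings_formula M \<Lambda> w f (\<lambda>m. {b. (m, b) \<in> S})"

definition nonneg_set_fun :: "'e set \<Rightarrow> ('e set \<Rightarrow> real) \<Rightarrow> bool" where
  "nonneg_set_fun G F \<longleftrightarrow> (\<forall>A. A \<subseteq> G \<longrightarrow> 0 \<le> F A)"

definition monotone_set_fun :: "'e set \<Rightarrow> ('e set \<Rightarrow> real) \<Rightarrow> bool" where
  "monotone_set_fun G F \<longleftrightarrow> (\<forall>A B. A \<subseteq> B \<and> B \<subseteq> G \<longrightarrow> F A \<le> F B)"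

definition submodular_set_fun :: "'e set \<Rightarrow> ('e set \<Rightarrow> real) \<Rightarrow> bool" where
  "submodular_set_fun G F \<longleftrightarrow>
     (\<forall>A B e. A \<subseteq> B \<and> B \<subseteq> G \<and> e \<in> G \<and> e \<notin> B \<longrightarrow>
        F (A \<union> {e}) - F A \<ge> F (B \<union> {e}) - F B)"

end

theory Submission
  imports Defs
begin

text \<open>
  Write \<open>w = min w f + [w - f]\<^sub>+\<close>. A stored chunk saves its requester \<open>min w f\<close> if the copy is
  local and \<open>[w - f]\<^sub>+\<close> if a copy exists at any worker, so the savings separate into a modular
  part and a weighted coverage function, both with nonnegative weights.
\<close>

text \<open>Three cases: a local copy saves all of \<open>w m b\<close>, a remote copy alone saves
  \<open>w - min w f = max (w - f) 0\<close>, no copy saves nothing. Since \<open>m\<close> is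
  itself a worker, a local copy also puts \<open>b\<close> into the union, so both summands occur
  and add up to \<open>w m b\<close>.\<close>

lemma unit_saving:
  assumes "m \<in> {1..M}"
  shows "w m b - unit_cost M w f T m b =
    (if b \<in> T m then min (w m b) (f m b) else 0)
    + (if b \<in> (\<Union>h\<in>{1..M}. T h) then max (w m b - f m b) 0 else 0)"
  using assms by (auto simp: unit_cost_def)

lemma total_savings_eq_savings_formula:
  assumes "finite V" and sub: "\<And>m. m \<in> {1..M} \<Longrightarrow> T m \<subseteq> V"
  shows "total_savings V M \<Lambda> w f T = savings_formula M \<Lambda> w f T"
proof -
  let ?U = "\<Union>h\<in>{1..M}. T h"
  let ?cov = "\<lambda>m b. \<Lambda> m b * max (w m b - f m b) 0"
  have "total_savings V M \<Lambda> w f T =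
      (\<Sum>m=1..M. \<Sum>b\<in>V. \<Lambda> m b * (w m b - unit_cost M w f T m b))"
    by (simp add: total_savings_def baseline_cost_def total_cost_def
        sum_subtractf right_diff_distrib)
  also have "\<dots> = (\<Sum>m=1..M. \<Sum>b\<in>V. (if b \<in> T m then local_gain \<Lambda> w f m b else 0)
      + (if b \<in> ?U then ?cov m b else 0))"
    by (intro sum.cong refl) (simp only: unit_saving local_gain_def, simp add: distrib_left)
  also have "\<dots> = (\<Sum>m=1..M. \<Sum>b\<in>V. if b \<in> T m then local_gain \<Lambda> w f m b else 0)
      + (\<Sum>b\<in>V. \<Sum>m=1..M. if b \<in> ?U then ?cov m b else 0)"
    \<comment> \<open>Fixing the inner index set to \<open>V\<close> keeps the swap from looping; it
      brings the double sums on both sides to the order with \<open>V\<close> outermost.\<close>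
    by (simp only: sum.distrib sum.swap[of _ V])
  also have "(\<Sum>m=1..M. \<Sum>b\<in>V. if b \<in> T m then local_gain \<Lambda> w f m b else 0)
      = (\<Sum>m=1..M. \<Sum>b\<in>T m. local_gain \<Lambda> w f m b)"
    by (rule sum.cong[OF refl])
      (simp only: sum.inter_restrict[OF \<open>finite V\<close>, symmetric] Int_absorb1[OF sub])
  \<comment> \<open>The condition does not depend on \<open>m\<close>, so the inner sum is either
    the full coverage gain of \<open>b\<close> or 0.\<close>
  also have "(\<Sum>b\<in>V. \<Sum>m=1..M. if b \<in> ?U then ?cov m b else 0)
      = (\<Sum>b\<in>V. if b \<in> ?U then coverage_gain M \<Lambda> w f b else 0)"
    by (intro sum.cong refl) (simp add: coverage_gain_def)
  also have "\<dots> = (\<Sum>b\<in>V \<inter> ?U. coverage_gain M \<Lambda> w f b)"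
    by (rule sum.inter_restrict[OF \<open>finite V\<close>, symmetric])
  also have "V \<inter> ?U = ?U"
    using sub by blast
  finally show ?thesis
    by (simp add: savings_formula_def)
qed

text \<open>The slices of \<open>S\<close> at the workers partition \<open>S\<close>, and their
  union is the projection of \<open>S\<close> to chunks. In this form, adding a placement element
  inserts one point into each index set.\<close>

lemma savings_set_fun_eq:
  assumes "finite V" and S: "S \<subseteq> ground_set M V"
  shows "savings_set_fun M \<Lambda> w f S =
    (\<Sum>(m, b)\<in>S. local_gain \<Lambda> w f m b) + (\<Sum>b\<in>snd ` S. coverage_gain M \<Lambda> w f b)"
proof -
  have "finite {b. (m, b) \<in> S}" for m
    using S by (intro finite_subset[OF _ \<open>finite V\<close>]) (auto simp: ground_set_def)
  then have "(\<Sum>m=1..M. \<Sum>b\<in>{b. (m, b) \<in> S}. local_gain \<Lambda> w f m b)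
      = (\<Sum>(m, b)\<in>(SIGMA m:{1..M}. {b. (m, b) \<in> S}). local_gain \<Lambda> w f m b)"
    by (intro sum.Sigma) auto
  also have "(SIGMA m:{1..M}. {b. (m, b) \<in> S}) = S"
    using S by (auto simp: ground_set_def)
  finally have "(\<Sum>m=1..M. \<Sum>b\<in>{b. (m, b) \<in> S}. local_gain \<Lambda> w f m b)
      = (\<Sum>(m, b)\<in>S. local_gain \<Lambda> w f m b)" .
  moreover have "(\<Union>m\<in>{1..M}. {b. (m, b) \<in> S}) = snd ` S"
    using S by (force simp: ground_set_def)
  ultimately show ?thesis
    by (simp only: savings_set_fun_def savings_formula_def)
qed

text \<open>This isolates how a marginal gain depends on \<open>S\<close>: only through whether some
  worker already stores \<open>b\<close>.\<close>

lemma savings_set_fun_marginal: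
  assumes "finite V" "S \<subseteq> ground_set M V" "(m, b) \<in> ground_set M V" "(m, b) \<notin> S"
  shows "savings_set_fun M \<Lambda> w f (S \<union> {(m, b)}) - savings_set_fun M \<Lambda> w f S =
    local_gain \<Lambda> w f m b + (if b \<in> snd ` S then 0 else coverage_gain M \<Lambda> w f b)"
proof -
  have "finite S"
    using assms(1,2) by (auto simp: ground_set_def intro: finite_subset)
  have "savings_set_fun M \<Lambda> w f (insert (m, b) S) =
      (\<Sum>(m, b)\<in>insert (m, b) S. local_gain \<Lambda> w f m b)
      + (\<Sum>b\<in>snd ` insert (m, b) S. coverage_gain M \<Lambda> w f b)"
    using assms by (intro savings_set_fun_eq) auto
  \<comment> \<open>The pair is new to \<open>S\<close>, but \<open>b\<close> may already lie in the
    projection; \<open>sum.insert_if\<close> covers both situations.\<close>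
  then show ?thesis
    using \<open>finite S\<close> \<open>(m, b) \<notin> S\<close>
    by (simp add: savings_set_fun_eq[OF assms(1,2)] sum.insert_if)
qed

theorem lemma1:
  fixes N V :: "'v set" and r :: 'v and E :: "('v \<times> 'v) set"
    and M :: nat and k :: "nat \<Rightarrow> nat"
    and \<Lambda> w f :: "nat \<Rightarrow> 'v \<Rightarrow> real"
  assumes tree: "prefix_tree N r E V"
    and demand: "\<And>m b. m \<in> {1..M} \<Longrightarrow> b \<in> V \<Longrightarrow> \<Lambda> m b \<ge> 0"
    and recompute: "\<And>m b. m \<in> {1..M} \<Longrightarrow> b \<in> V \<Longrightarrow> w m b \<ge> 0"
    and fetch: "\<And>m b. m \<in> {1..M} \<Longrightarrow> b \<in> V \<Longrightarrow> f m b \<ge> 0"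
  shows "(\<forall>T. feasible E V M k T \<longrightarrow>
            total_savings V M \<Lambda> w f T = savings_formula M \<Lambda> w f T)
       \<and> nonneg_set_fun (ground_set M V) (savings_set_fun M \<Lambda> w f)
       \<and> monotone_set_fun (ground_set M V) (savings_set_fun M \<Lambda> w f)
       \<and> submodular_set_fun (ground_set M V) (savings_set_fun M \<Lambda> w f)"
proof (intro conjI allI impI)
  have "finite V"
    using tree by (simp add: prefix_tree_def)
  have gain: "local_gain \<Lambda> w f m b \<ge> 0" if "(m, b) \<in> ground_set M V" for m b
    using that demand recompute fetch by (simp add: local_gain_def ground_set_def)
  have cov: "coverage_gain M \<Lambda> w f b \<ge> 0" if "b \<in> V" for b
    using that demand by (auto simp: coverage_gain_def intro!: sum_nonneg)
  let ?F = "savings_set_fun M \<Lambda> w f"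
  note F_eq = savings_set_fun_eq[OF \<open>finite V\<close>, of _ M \<Lambda> w f]
  show "total_savings V M \<Lambda> w f T = savings_formula M \<Lambda> w f T" if "feasible E V M k T" for T
    using that by (intro total_savings_eq_savings_formula \<open>finite V\<close>) (simp add: feasible_def)
  have snd_sub: "snd ` S \<subseteq> V" if "S \<subseteq> ground_set M V" for S
    using that by (auto simp: ground_set_def)
  show mono: "monotone_set_fun (ground_set M V) ?F"
    unfolding monotone_set_fun_def
  proof (intro allI impI, elim conjE)
    fix A B
    assume AB: "A \<subseteq> B" and B: "B \<subseteq> ground_set M V"
    have "finite B"
      using B \<open>finite V\<close> by (auto simp: ground_set_def intro: finite_subset)
    \<comment> \<open>Both index sets grow with the placement set, and the terms are nonnegative on
      the larger one.\<close>
    have "(\<Sum>(m, b)\<in>A. local_gain \<Lambda> w f m b) \<le> (\<Sum>(m, b)\<in>B. local_gain \<Lambda> w f m b)"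
      using \<open>finite B\<close> AB B gain by (intro sum_mono2) auto
    moreover have "(\<Sum>b\<in>snd ` A. coverage_gain M \<Lambda> w f b) \<le> (\<Sum>b\<in>snd ` B. coverage_gain M \<Lambda> w f b)"
      using \<open>finite B\<close> AB snd_sub[OF B] cov by (intro sum_mono2) auto
    ultimately show "?F A \<le> ?F B"
      using AB B by (simp add: F_eq)
  qed
  \<comment> \<open>By monotonicity the empty set minimizes \<open>?F\<close>, so its value 0 is a
    lower bound.\<close>
  have "?F {} = 0"
    by (simp add: F_eq)
  then show "nonneg_set_fun (ground_set M V) ?F"
    using mono unfolding nonneg_set_fun_def monotone_set_fun_def
    by (metis empty_subsetI)
  show "submodular_set_fun (ground_set M V) ?F"
    unfolding submodular_set_fun_def
  proof (intro allI impI, elim conjE)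
    fix A B e
    assume AB: "A \<subseteq> B" and B: "B \<subseteq> ground_set M V" and e: "e \<in> ground_set M V" "e \<notin> B"
    obtain m b where mb: "e = (m, b)"
      by (cases e)
    have A: "A \<subseteq> ground_set M V" "(m, b) \<notin> A"
      using AB B e mb by auto
    \<comment> \<open>The marginal gains at \<open>A\<close> and \<open>B\<close> differ only if
      \<open>b\<close> is covered by exactly one of the two sets. As coverage grows with the set,
      that one is \<open>B\<close>, and the gain at \<open>A\<close> is then larger by this
      nonnegative amount.\<close>
    have "coverage_gain M \<Lambda> w f b \<ge> 0"
      using cov e mb by (simp add: ground_set_def)
    moreover have "snd ` A \<subseteq> snd ` B"
      using AB by (rule image_mono)
    ultimately show "?F (A \<union> {e}) - ?F A \<ge> ?F (B \<union> {e}) - ?F B"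
      using savings_set_fun_marginal[OF \<open>finite V\<close> A(1) _ A(2)]
        savings_set_fun_marginal[OF \<open>finite V\<close> B, of m b] e mb
      by auto
  qed
qed

end
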